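(* For every $d\ge 1$ there is a constant $C_d$, depending only on $d$, such that the following holds. Let $g:\mathbb{R}^d\to\overline{\mathbb{R}}$ be proper, convex and lower semicontinuous, let $f:\mathbb{R}^d\to\mathbb{R}$ be a differentiable convex function whose gradient is Lipschitz continuous with constant $L>0$, and suppose that $\mathcal{S}:=\operatorname{argmin}(f+g)$ is nonempty. Let $x_0\in\mathbb{R}^d$ and $$x_{k+1}=\operatorname{prox}_{\alpha_k g}\big(x_k-\alpha_k\nabla f(x_k)\big),\qquad\forall k\ge 0,$$ where the stepsizes $\alpha_k>0$ satisfy at least one of the following: (i) $\alpha_k\in(0,1/L)$ for all $k$; (ii) the $\alpha_k$ are produced by backtracking line search; (iii) $f=0$ (and $\alpha_k>0$ is arbitrary); (iv) $g=0$ and $\alpha_k\le 1/L$ for all $k$. Then $$\sum_{k=0}^\infty\|x_{k+1}-x_k\|\le C_d\, d_{\mathcal{S}}(x_0)<+\infty,$$ and consequently $\{x_k\}$ converges to some $x_\infty\in\mathbb{R}^d$. If in addition $\{\alpha_k\}_{k\in\mathbb{N}}\notin\ell^1(\mathbb{N})$, i.e. $\sum_k\alpha_k=+\infty$, then $x_\infty\in\mathcal{S}$.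
   Context: $\mathbb{R}^d$ is the $d$-dimensional Euclidean space with inner product $\langle\cdot,\cdot\rangle$ and norm $\|\cdot\|$; $\overline{\mathbb{R}}$ denotes the extended reals; $d_{\mathcal{S}}(x)=\inf_{s\in\mathcal{S}}\|x-s\|$. For $\beta>0$, $\operatorname{prox}_{\beta g}(x)$ is the unique minimizer over $z\in\mathbb{R}^d$ of $g(z)+\frac{1}{2\beta}\|z-x\|^2$. Backtracking line search: fix $\alpha>0$ and $0<q<1$, and write $T_\beta(x)=\operatorname{prox}_{\beta g}(x-\beta\nabla f(x))$ for $\beta>0$. At each iteration $k\ge0$, set $\alpha_k=\alpha$; while $$f(T_{\alpha_k}(x_k))>f(x_k)+\langle\nabla f(x_k),T_{\alpha_k}(x_k)-x_k\rangle+\frac{1}{2\alpha_k}\|T_{\alpha_k}(x_k)-x_k\|^2,$$ replace $\alpha_k$ by $q\alpha_k$; the final value is the stepsize $\alpha_k$ (that is, $\alpha_k$ is the first element of $\alpha,\alpha q,\alpha q^2,\dots$ for which the displayed strict inequality fails). *)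

theory Defs
  imports "HOL-Analysis.Analysis"
begin

definition proper_fun :: "('a \<Rightarrow> ereal) \<Rightarrow> bool" where
  "proper_fun g \<longleftrightarrow> (\<forall>x. g x \<noteq> -\<infinity>) \<and> (\<exists>x. g x \<noteq> \<infinity>)"

(* convex_on is only available for real-valued functions. The endpoints t = 0, 1 are left out,
   so no product 0 * \<infinity> occurs; for proper g no sum \<infinity> + (-\<infinity>) occurs either. *)
definition convex_fun :: "('a::real_vector \<Rightarrow> ereal) \<Rightarrow> bool" where
  "convex_fun g \<longleftrightarrow> (\<forall>x y. \<forall>t::real. 0 < t \<longrightarrow> t < 1 \<longrightarrow>
     g ((1 - t) *\<^sub>R x + t *\<^sub>R y) \<le> ereal (1 - t) * g x + ereal t * g y)"

definition lsc_fun :: "('a::topological_space \<Rightarrow> ereal) \<Rightarrow> bool" where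
  "lsc_fun g \<longleftrightarrow> (\<forall>x. g x \<le> Liminf (at x) g)"

definition argmin_set :: "('a \<Rightarrow> 'b::ord) \<Rightarrow> 'a set" where
  "argmin_set h = {x. is_arg_min h (\<lambda>_. True) x}"

(* Meaningful at points where f is differentiable, see gradient_eqI and GDERIV_gradient. *)
definition gradient :: "('a::euclidean_space \<Rightarrow> real) \<Rightarrow> 'a \<Rightarrow> 'a" where
  "gradient f x = (THE D. GDERIV f x :> D)"

lemma gradient_eqI:
  assumes "GDERIV f x :> D"
  shows "gradient f x = D"
  unfolding gradient_def
proof (rule the_equality)
  show "GDERIV f x :> D" by (fact assms)
next
  fix D' assume "GDERIV f x :> D'"
  then have "(\<lambda>h. h \<bullet> D') = (\<lambda>h. h \<bullet> D)"
    using assms unfolding gderiv_def by (intro has_derivative_unique)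
  then have "\<forall>h. h \<bullet> D' = h \<bullet> D"
    by (simp add: fun_eq_iff)
  then show "D' = D"
    by (simp add: vector_eq_ldot)
qed

lemma GDERIV_gradient:
  assumes "f differentiable (at x)"
  shows "GDERIV f x :> gradient f x"
proof -
  obtain f' where f': "(f has_derivative f') (at x)"
    using assms unfolding differentiable_def by blast
  then interpret bounded_linear f' by (rule has_derivative_bounded_linear)
  have "f' = (\<lambda>h. h \<bullet> (\<Sum>b\<in>Basis. f' b *\<^sub>R b))"
  proof
    fix h
    have "f' h = f' (\<Sum>b\<in>Basis. (h \<bullet> b) *\<^sub>R b)"
      by (simp add: euclidean_representation)
    also have "\<dots> = h \<bullet> (\<Sum>b\<in>Basis. f' b *\<^sub>R b)"
      by (simp only: sum scaleR inner_sum_right inner_scaleR_right real_scaleR_def mult.commute)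
    finally show "f' h = h \<bullet> (\<Sum>b\<in>Basis. f' b *\<^sub>R b)" .
  qed
  with f' have *: "GDERIV f x :> (\<Sum>b\<in>Basis. f' b *\<^sub>R b)"
    unfolding gderiv_def by (rule back_subst)
  show ?thesis
    unfolding gradient_eqI[OF *] by (rule *)
qed

(* prox \<beta> g is the map usually written with the subscript \<beta>g. The minimizer exists and is
   unique for \<beta> > 0 and g proper, convex and lower semicontinuous. *)
definition prox :: "real \<Rightarrow> ('a::euclidean_space \<Rightarrow> ereal) \<Rightarrow> 'a \<Rightarrow> 'a" where
  "prox \<beta> g x =
     (THE z. z \<in> argmin_set (\<lambda>z. g z + ereal (1 / (2 * \<beta>) * (norm (z - x))\<^sup>2)))"

definition fb_step ::
    "('a::euclidean_space \<Rightarrow> real) \<Rightarrow> ('a \<Rightarrow> ereal) \<Rightarrow> real \<Rightarrow> 'a \<Rightarrow> 'a" where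
  "fb_step f g \<beta> x = prox \<beta> g (x - \<beta> *\<^sub>R gradient f x)"

definition backtrack_test ::
    "('a::euclidean_space \<Rightarrow> real) \<Rightarrow> ('a \<Rightarrow> ereal) \<Rightarrow> real \<Rightarrow> 'a \<Rightarrow> bool" where
  "backtrack_test f g \<beta> x \<longleftrightarrow>
     f (fb_step f g \<beta> x) > f x + gradient f x \<bullet> (fb_step f g \<beta> x - x)
       + 1 / (2 * \<beta>) * (norm (fb_step f g \<beta> x - x))\<^sup>2"

(* The step at iteration k is the first element of \<alpha>0, \<alpha>0 q, \<alpha>0 q^2, ... failing the loop test;
   every iteration restarts from the same \<alpha>0. *)
definition backtracking_steps ::
    "('a::euclidean_space \<Rightarrow> real) \<Rightarrow> ('a \<Rightarrow> ereal) \<Rightarrow> real \<Rightarrow> real \<Rightarrow>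
      (nat \<Rightarrow> 'a) \<Rightarrow> (nat \<Rightarrow> real) \<Rightarrow> bool" where
  "backtracking_steps f g \<alpha>0 q x \<alpha> \<longleftrightarrow> (\<forall>k. \<exists>j. \<alpha> k = \<alpha>0 * q ^ j
     \<and> \<not> backtrack_test f g (\<alpha>0 * q ^ j) (x k)
     \<and> (\<forall>i<j. backtrack_test f g (\<alpha>0 * q ^ i) (x k)))"

end

(* An accepted forward-backward step from x to x' satisfies, for F = f + g and every z,
   F(x') + (|x' - z|^2 - |x - z|^2) / (2 \<alpha>) <= F(z). Hence the step brings the iterate closer to every z
   with F(z) <= F(x'), in particular to all later iterates and to all minimizers: the sequence is
   self-contracted and stays within distance d_S(x_0) of a minimizer.

   A self-contracted sequence has length bounded by its radius: seen from x_n, the later points lie in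
   pairwise non-obtuse directions, so some w from a fixed finite set P makes an angle bounded away
   from a right angle with all of them. Therefore the infimum of w . x_k over k >= n grows by at least a
   multiple of |x_(n+1) - x_n| when n is increased, and the sum of these infima over w in P is a
   bounded nondecreasing potential. *)
theory Submission
  imports Defs
begin

section \<open>Acute families of unit directions\<close>

text \<open>Cover the sphere by finitely many cells and let \<open>z\<close> be the sum of one
  representative from each cell that meets \<open>U\<close>. The representative in the cell of
  \<open>u\<close> contributes at least 1/2 to the product of \<open>z\<close> with
  \<open>u\<close>, and the others contribute nonnegative amounts by acuteness. The norm of
  \<open>z\<close> is at most the number of cells, whatever \<open>U\<close> is, so \<open>z\<close>
  can be rounded to a point of a fixed finite net of a ball at a cost of at most 1/4.\<close>

lemma finite_net_of_acute_directions:
  obtains P :: "'a::euclidean_space set" where "finite P"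
    "\<forall>U \<subseteq> sphere 0 1. (\<forall>u\<in>U. \<forall>v\<in>U. 0 \<le> u \<bullet> v) \<longrightarrow> (\<exists>w\<in>P. \<forall>u\<in>U. 1 / 4 \<le> w \<bullet> u)"
proof -
  obtain N :: "'a set" where N: "finite N" "sphere 0 1 \<subseteq> (\<Union>a\<in>N. ball a (1 / 2))"
    using compact_sphere[of "0::'a" 1] unfolding compact_eq_totally_bounded
    by (meson half_gt_zero zero_less_one)
  obtain P :: "'a set" where P: "finite P" "cball 0 (card N) \<subseteq> (\<Union>a\<in>P. ball a (1 / 4))"
    using compact_cball[of "0::'a" "real (card N)"] unfolding compact_eq_totally_bounded
    by (meson divide_pos_pos zero_less_numeral zero_less_one)
  show thesis
  proof (rule that[OF P(1)], intro allI impI)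
    fix U :: "'a set"
    assume U: "U \<subseteq> sphere 0 1" and acute: "\<forall>u\<in>U. \<forall>v\<in>U. 0 \<le> u \<bullet> v"
    define A where "A = {a \<in> N. \<exists>u\<in>U. u \<in> ball a (1 / 2)}"
    have A: "finite A" "card A \<le> card N"
      using N(1) unfolding A_def by (auto intro: card_mono)
    obtain r where r: "\<And>a. a \<in> A \<Longrightarrow> r a \<in> U \<and> r a \<in> ball a (1 / 2)"
      using bchoice[of A "\<lambda>a u. u \<in> U \<and> u \<in> ball a (1 / 2)"] unfolding A_def by blast
    define z where "z = (\<Sum>a\<in>A. r a)"
    have "norm z \<le> (\<Sum>a\<in>A. norm (r a))"
      unfolding z_def by (rule norm_sum)
    also have "\<dots> = (\<Sum>a\<in>A. 1)"
    proof (rule sum.cong[OF refl])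
      fix a assume "a \<in> A"
      then have "r a \<in> sphere 0 1"
        using r U by blast
      then show "norm (r a) = 1"
        by simp
    qed
    finally have "z \<in> cball 0 (card N)"
      using A(2) by simp
    then obtain w where w: "w \<in> P" "norm (w - z) < 1 / 4"
      using P(2) by (auto simp: dist_norm)
    have "1 / 4 \<le> w \<bullet> u" if u: "u \<in> U" for u
    proof -
      have nu: "norm u = 1"
        using u U by auto
      obtain a where a: "a \<in> N" "u \<in> ball a (1 / 2)"
        using u U N(2) by blast
      then have aA: "a \<in> A"
        using u unfolding A_def by blast
      \<comment> \<open>Both points lie in the same ball of radius 1/2. For unit vectors the squared
        distance is 2 - 2 (\<open>r a\<close> . \<open>u\<close>), so a distance below 1 yields the
        product bound 1/2.\<close>
      have "norm (r a - u) < 1"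
        using r[OF aA] a dist_triangle_half_r[of a "r a" 1 u] by (simp add: dist_norm)
      then have "(norm (r a - u))\<^sup>2 < 1"
        by (simp add: power_less_one_iff)
      moreover have "norm (r a) = 1"
        using r[OF aA] U by (auto simp del: mem_ball)
      ultimately have "1 / 2 \<le> r a \<bullet> u"
        using nu by (simp add: power2_norm_eq_inner inner_diff inner_commute norm_eq_1)
      also have "\<dots> \<le> (\<Sum>b\<in>A. r b \<bullet> u)"
        using A(1) aA r u acute by (intro member_le_sum) auto
      also have "\<dots> = z \<bullet> u"
        unfolding z_def by (simp add: inner_sum_left)
      finally have "1 / 2 \<le> z \<bullet> u" .
      moreover have "\<bar>(w - z) \<bullet> u\<bar> \<le> norm (w - z) * norm u"
        by (rule Cauchy_Schwarz_ineq2)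
      ultimately show ?thesis
        using w(2) nu by (simp add: inner_diff_left abs_le_iff)
    qed
    then show "\<exists>w\<in>P. \<forall>u\<in>U. 1 / 4 \<le> w \<bullet> u"
      using w(1) by blast
  qed
qed

section \<open>Length of self-contracted sequences\<close>

text \<open>The discrete counterpart of the self-contracted curves that arise as gradient flows of
  convex functions.\<close>

definition self_contracted :: "(nat \<Rightarrow> 'a::metric_space) \<Rightarrow> bool" where
  "self_contracted x \<longleftrightarrow> (\<forall>i j k. i \<le> j \<longrightarrow> j \<le> k \<longrightarrow> dist (x j) (x k) \<le> dist (x i) (x k))"

lemma self_contractedD:
  "self_contracted x \<Longrightarrow> i \<le> j \<Longrightarrow> j \<le> k \<Longrightarrow> dist (x j) (x k) \<le> dist (x i) (x k)"
  unfolding self_contracted_def by blast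

text \<open>In the triangle formed by \<open>x n\<close>, \<open>x j\<close>, \<open>x k\<close>
  with j \<le> k, the side from \<open>x j\<close> to \<open>x k\<close> is no longer than the side
  from \<open>x n\<close> to \<open>x k\<close>; expanding the squares bounds the inner product
  below by half the squared norm of \<open>x j - x n\<close>. The other order of j and k follows by
  symmetry.\<close>

lemma self_contracted_acute:
  fixes x :: "nat \<Rightarrow> 'a::real_inner"
  assumes "self_contracted x" "n \<le> j" "n \<le> k"
  shows "0 \<le> (x j - x n) \<bullet> (x k - x n)"
proof -
  have *: "0 \<le> (x j - x n) \<bullet> (x k - x n)" if "n \<le> j" "j \<le> k" for j k
  proof -
    have "norm ((x k - x n) - (x j - x n)) \<le> norm (x k - x n)"
      using self_contractedD[OF assms(1) that] by (simp add: dist_norm norm_minus_commute)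
    then have "(norm ((x k - x n) - (x j - x n)))\<^sup>2 \<le> (norm (x k - x n))\<^sup>2"
      by (simp add: power_mono)
    then have "(norm (x j - x n))\<^sup>2 \<le> 2 * ((x j - x n) \<bullet> (x k - x n))"
      unfolding power2_norm_eq_inner by (simp add: inner_diff inner_commute)
    then show ?thesis
      using zero_le_power2[of "norm (x j - x n)"] by linarith
  qed
  show ?thesis
    using *[of j k] *[of k j] assms by (metis inner_commute nle_le)
qed

text \<open>\<open>P\<close> is fixed before the sequence, so the constant depends on the space
  alone. In the factor 16, 8 comes from the gain per step and 2 from the range of each
  \<open>h w\<close>, which lies between \<open>- (norm w * D)\<close> and
  \<open>norm w * D\<close>. Bounding partial sums lets summability be deduced afterwards.\<close>

theorem self_contracted_length_le:
  obtains C :: real where "0 \<le> C"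
    "\<And>(x :: nat \<Rightarrow> 'a::euclidean_space) c D n. self_contracted x
      \<Longrightarrow> (\<And>k. dist (x k) c \<le> D) \<Longrightarrow> (\<Sum>k<n. norm (x (Suc k) - x k)) \<le> C * D"
proof -
  obtain P :: "'a set" where P: "finite P"
    "\<forall>U \<subseteq> sphere 0 1. (\<forall>u\<in>U. \<forall>v\<in>U. 0 \<le> u \<bullet> v) \<longrightarrow> (\<exists>w\<in>P. \<forall>u\<in>U. 1 / 4 \<le> w \<bullet> u)"
    by (rule finite_net_of_acute_directions)
  show thesis
  proof (rule that)
    show "0 \<le> 16 * (\<Sum>w\<in>P. norm w)"
      by (simp add: sum_nonneg)
  next
    fix x :: "nat \<Rightarrow> 'a" and c D n
    assume sc: "self_contracted x" and D: "\<And>k. dist (x k) c \<le> D"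
    define h where "h w n = (INF k\<in>{n..}. w \<bullet> (x k - c))" for w n
    have abs_le: "\<bar>w \<bullet> (x k - c)\<bar> \<le> norm w * D" for w k
      using Cauchy_Schwarz_ineq2[of w "x k - c"] mult_left_mono[OF D, of "norm w" k]
      by (simp add: dist_norm)
    \<comment> \<open>The real-valued infimum \<open>h\<close> is a genuine infimum only because
      these sets are bounded below.\<close>
    have bdd: "bdd_below ((\<lambda>k. w \<bullet> (x k - c)) ` A)" for w A
      using abs_le by (intro bdd_belowI2[of _ "- (norm w * D)"]) (simp add: abs_le_iff minus_le_iff)
    have h_le: "h w n \<le> w \<bullet> (x k - c)" if "n \<le> k" for w n k
      unfolding h_def using that by (intro cINF_lower bdd) auto
    have h_greatest: "b \<le> h w n" if "\<And>k. n \<le> k \<Longrightarrow> b \<le> w \<bullet> (x k - c)" for b w n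
      unfolding h_def using that by (intro cINF_greatest) auto
    have h_mono: "h w n \<le> h w (Suc n)" for w n
      by (rule h_greatest) (simp add: h_le)
    have step: "norm (x (Suc n) - x n) / 8 \<le> (\<Sum>w\<in>P. h w (Suc n)) - (\<Sum>w\<in>P. h w n)" for n
    proof -
      \<comment> \<open>Points equal to \<open>x n\<close> have no direction, since
        \<open>sgn 0 = 0\<close> is off the sphere; they are treated separately in the case
        distinction on \<open>x k = x n\<close>.\<close>
      define U where "U = {sgn (x k - x n) |k. Suc n \<le> k \<and> x k \<noteq> x n}"
      have "U \<subseteq> sphere 0 1"
        unfolding U_def by (auto simp: norm_sgn)
      moreover have "\<forall>u\<in>U. \<forall>v\<in>U. 0 \<le> u \<bullet> v"
      proof (intro ballI)
        fix u v assume "u \<in> U" "v \<in> U"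
        then show "0 \<le> u \<bullet> v"
          using self_contracted_acute[OF sc] unfolding U_def
          by (auto simp: sgn_div_norm intro!: mult_nonneg_nonneg)
      qed
      ultimately have "\<exists>w\<in>P. \<forall>u\<in>U. 1 / 4 \<le> w \<bullet> u"
        using P(2)[THEN spec, of U] by simp
      then obtain w where w: "w \<in> P" "\<And>u. u \<in> U \<Longrightarrow> 1 / 4 \<le> w \<bullet> u"
        by auto
      have "h w n + norm (x (Suc n) - x n) / 8 \<le> h w (Suc n)"
      proof (rule h_greatest)
        fix k assume k: "Suc n \<le> k"
        \<comment> \<open>Go from \<open>x (Suc n)\<close> to \<open>x n\<close> through
          \<open>x k\<close>: self-contraction bounds the first leg by the second. With the slope
          1/4 in direction \<open>w\<close> this gives the gain 1/8.\<close>
        have "norm (x (Suc n) - x n) \<le> 2 * norm (x k - x n)"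
          using self_contractedD[OF sc _ k, of n] dist_triangle[of "x (Suc n)" "x n" "x k"]
          by (simp add: dist_norm norm_minus_commute)
        moreover have "norm (x k - x n) / 4 \<le> w \<bullet> (x k - x n)"
        proof (cases "x k = x n")
          case False
          with k have "1 / 4 \<le> w \<bullet> sgn (x k - x n)"
            by (intro w) (auto simp: U_def)
          with False show ?thesis
            by (simp add: sgn_div_norm inverse_eq_divide pos_le_divide_eq)
        qed simp
        moreover have "h w n \<le> w \<bullet> (x n - c)"
          by (simp add: h_le)
        ultimately show "h w n + norm (x (Suc n) - x n) / 8 \<le> w \<bullet> (x k - c)"
          by (simp add: inner_diff_right)
      qed
      then have "norm (x (Suc n) - x n) / 8 \<le> h w (Suc n) - h w n"
        by simp
      \<comment> \<open>The good direction \<open>w\<close> changes with \<open>n\<close>; summing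
        over all of \<open>P\<close> absorbs this, as no other \<open>h w\<close> decreases.\<close>
      also have "\<dots> \<le> (\<Sum>w\<in>P. h w (Suc n) - h w n)"
        using P(1) w(1) h_mono by (intro member_le_sum) auto
      finally show ?thesis
        by (simp add: sum_subtractf)
    qed
    have "(\<Sum>k<n. norm (x (Suc k) - x k)) / 8
        \<le> (\<Sum>k<n. (\<Sum>w\<in>P. h w (Suc k)) - (\<Sum>w\<in>P. h w k))"
      unfolding sum_divide_distrib by (intro sum_mono step)
    also have "\<dots> = (\<Sum>w\<in>P. h w n - h w 0)"
      by (subst sum_lessThan_telescope) (simp add: sum_subtractf)
    also have "\<dots> \<le> (\<Sum>w\<in>P. 2 * (norm w * D))"
    proof (rule sum_mono)
      fix w
      have "h w n \<le> norm w * D"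
        using h_le[of n n w] abs_le[of w n] by simp
      moreover have "- (norm w * D) \<le> h w 0"
        using abs_le[of w] by (intro h_greatest) (simp add: abs_le_iff minus_le_iff)
      ultimately show "h w n - h w 0 \<le> 2 * (norm w * D)"
        by simp
    qed
    also have "\<dots> = 2 * (\<Sum>w\<in>P. norm w) * D"
      by (simp flip: sum_distrib_left sum_distrib_right)
    finally show "(\<Sum>k<n. norm (x (Suc k) - x k)) \<le> 16 * (\<Sum>w\<in>P. norm w) * D"
      by simp
  qed
qed

section \<open>Lower semicontinuity and attainment of minima\<close>

text \<open>\<open>Liminf (at y)\<close> ignores the value at \<open>y\<close>, but
  \<open>c < g y\<close> covers that point, so the punctured neighbourhoods may be replaced by full
  ones.\<close>

lemma lsc_fun_iff_open: "lsc_fun g \<longleftrightarrow> (\<forall>c. open {y. c < g y})"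
proof -
  have "(\<forall>y. g y \<le> Liminf (at y) g) \<longleftrightarrow> (\<forall>c y. c < g y \<longrightarrow> (\<forall>\<^sub>F z in nhds y. c < g z))"
    unfolding le_Liminf_iff eventually_nhds_conv_at by blast
  also have "\<dots> \<longleftrightarrow> (\<forall>c. open {y. c < g y})"
    by (subst open_subopen) (auto simp: eventually_nhds subset_eq)
  finally show ?thesis
    unfolding lsc_fun_def .
qed

lemma lsc_fun_add_continuous:
  assumes "lsc_fun g" "continuous_on UNIV f"
  shows "lsc_fun (\<lambda>y. ereal (f y) + g y)"
  unfolding lsc_fun_iff_open
proof
  have g: "open {y. c < g y}" for c
    using assms(1) unfolding lsc_fun_iff_open by blast
  fix c
  show "open {y. c < ereal (f y) + g y}"
  proof (cases c)
    case (real r)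
    \<comment> \<open>The threshold \<open>r\<close> is split by an intermediate real
      \<open>s\<close> into one condition on \<open>f\<close> and one on \<open>g\<close>, each of
      them open.\<close>
    have "{y. c < ereal (f y) + g y} = (\<Union>s. {y. r - s < f y} \<inter> {y. ereal s < g y})"
    proof (intro set_eqI iffI)
      fix y assume "y \<in> {y. c < ereal (f y) + g y}"
      then have "ereal (r - f y) < g y"
        using real by (cases "g y") auto
      then obtain s where "ereal (r - f y) < ereal s" "ereal s < g y"
        using ereal_dense2 by blast
      then have "r - s < f y" "ereal s < g y"
        by auto
      then show "y \<in> (\<Union>s. {y. r - s < f y} \<inter> {y. ereal s < g y})"
        by blast
    next
      fix y assume "y \<in> (\<Union>s. {y. r - s < f y} \<inter> {y. ereal s < g y})"
      then show "y \<in> {y. c < ereal (f y) + g y}"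
        using real by (cases "g y") auto
    qed
    moreover have "open {y. r - s < f y}" for s
      using assms(2) by (intro open_Collect_less) auto
    ultimately show ?thesis
      using g by (auto intro!: open_UN open_Int)
  next
    case MInf
    have "{y. c < ereal (f y) + g y} = {y. c < g y}"
      unfolding MInf by (auto simp: less_le)
    with g show ?thesis
      by simp
  qed simp
qed

text \<open>Without a minimum on \<open>K\<close>, the open sets where \<open>h\<close> exceeds
  \<open>h y\<close>, for \<open>y\<close> in \<open>K\<close>, cover \<open>K\<close>. In a finite
  subcover, the centre with the smallest value is left uncovered.\<close>

lemma lsc_fun_attains_min:
  assumes "lsc_fun h" "compact K" "K \<noteq> {}"
  obtains z where "z \<in> K" "\<And>y. y \<in> K \<Longrightarrow> h z \<le> h y"
proof (rule ccontr)
  assume "\<not> thesis"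
  then have cover: "K \<subseteq> (\<Union>y\<in>K. {z. h y < h z})"
    using that by force
  have opn: "open {z. h y < h z}" for y
    using assms(1) unfolding lsc_fun_iff_open by blast
  obtain F where F: "F \<subseteq> K" "finite F" "K \<subseteq> (\<Union>y\<in>F. {z. h y < h z})"
    by (rule compactE_image[OF assms(2) opn cover])
  then have "F \<noteq> {}"
    using assms(3) by auto
  then have "Min (h ` F) \<in> h ` F"
    using F(2) by (intro Min_in) auto
  then obtain z where z: "z \<in> F" "h z = Min (h ` F)"
    by (metis imageE)
  then obtain y where y: "y \<in> F" "h y < h z"
    using F by blast
  then have "Min (h ` F) \<le> h y"
    using F(2) by (intro Min_le) auto
  with y z show False
    by simp
qed

section \<open>Existence, uniqueness and variational inequality of the proximal point\<close>

lemma proper_fun_realE: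
  assumes "proper_fun g" "g y \<noteq> \<infinity>"
  obtains r where "g y = ereal r"
  using assms unfolding proper_fun_def by (metis ereal_cases)

text \<open>Let \<open>m\<close> be the minimum of \<open>g\<close> on the unit ball around
  \<open>y\<close>. For \<open>z\<close> outside, convexity on the segment from \<open>y\<close> to
  \<open>z\<close>, applied at its point \<open>v\<close> at distance 1 from \<open>y\<close>, shows
  that \<open>g\<close> falls at most linearly, with slope \<open>a - m\<close>. This gives the
  growth control needed for the proximal objective.\<close>

lemma convex_lsc_linear_minorant:
  fixes g :: "'a::euclidean_space \<Rightarrow> ereal"
  assumes "proper_fun g" "convex_fun g" "lsc_fun g" and y: "g y = ereal a"
  obtains b where "0 \<le> b" "\<And>z. ereal (a - b * (1 + norm (z - y))) \<le> g z"
proof -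
  obtain w where w: "w \<in> cball y 1" "\<And>z. z \<in> cball y 1 \<Longrightarrow> g w \<le> g z"
    using lsc_fun_attains_min[OF assms(3) compact_cball, of y 1] by auto
  have gw: "g w \<le> ereal a"
    using w(2)[of y] y by simp
  then obtain m where m: "g w = ereal m"
    using proper_fun_realE[OF assms(1), of w] by fastforce
  show thesis
  proof (rule that)
    show "0 \<le> a - m"
      using gw m by simp
    fix z
    define r where "r = norm (z - y)"
    show "ereal (a - (a - m) * (1 + norm (z - y))) \<le> g z"
    proof (cases "r \<le> 1")
      case True
      have "a - (a - m) * (1 + r) \<le> m"
        using gw m mult_left_mono[of m a r] by (simp add: r_def algebra_simps)
      also have "ereal m \<le> g z"
        using w(2)[of z] True m by (simp add: r_def dist_norm norm_minus_commute)
      finally show ?thesis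
        by (simp add: r_def)
    next
      case False
      define v where "v = (1 - 1 / r) *\<^sub>R y + (1 / r) *\<^sub>R z"
      have "v - y = (1 / r) *\<^sub>R (z - y)"
        by (simp add: v_def algebra_simps)
      then have "norm (v - y) = 1"
        using False by (auto simp: r_def)
      then have "ereal m \<le> g v"
        using w(2)[of v] m by (simp add: dist_norm norm_minus_commute)
      also have "\<dots> \<le> ereal (1 - 1 / r) * g y + ereal (1 / r) * g z"
        using assms(2) False unfolding convex_fun_def v_def by auto
      finally have *: "ereal m \<le> ereal (1 - 1 / r) * g y + ereal (1 / r) * g z" .
      show ?thesis
      proof (cases "g z = \<infinity>")
        case fin: False
        then obtain c where c: "g z = ereal c"
          using proper_fun_realE[OF assms(1)] by blast
        have "m \<le> (1 - 1 / r) * a + 1 / r * c"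
          using * y c by simp
        then have "r * m \<le> r * ((1 - 1 / r) * a + 1 / r * c)"
          using False by (intro mult_left_mono) auto
        also have "\<dots> = (r - 1) * a + c"
          using False by (simp add: field_simps)
        finally have "a - (a - m) * (1 + r) \<le> c"
          using gw m by (simp add: algebra_simps)
        then show ?thesis
          using c by (simp add: r_def)
      qed simp
    qed
  qed
qed

text \<open>The quadratic term beats the linear minorant of \<open>g\<close> far away, so a minimum
  over a large closed ball is global.\<close>

lemma prox_exists:
  fixes g :: "'a::euclidean_space \<Rightarrow> ereal"
  assumes "proper_fun g" "convex_fun g" "lsc_fun g" "0 < \<beta>"
  obtains p where "p \<in> argmin_set (\<lambda>z. g z + ereal (1 / (2 * \<beta>) * (norm (z - x))\<^sup>2))"
proof -
  define h where "h = (\<lambda>z. g z + ereal (1 / (2 * \<beta>) * (norm (z - x))\<^sup>2))"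
  obtain y where "g y \<noteq> \<infinity>"
    using assms(1) unfolding proper_fun_def by blast
  then obtain a where a: "g y = ereal a"
    using proper_fun_realE[OF assms(1)] by blast
  obtain b where b: "0 \<le> b" "\<And>z. ereal (a - b * (1 + norm (z - y))) \<le> g z"
    using convex_lsc_linear_minorant[OF assms(1-3) a] by metis
  define \<delta> where "\<delta> = norm (y - x)"
  \<comment> \<open>For r > \<open>R\<close>, the summand 1 gives 1 + r \<le> 2 r, and the rest
    gives r (r - 2 \<delta>) \<ge> 4 \<beta> b r. Together they make the quadratic gain exceed the
    linear loss 2 \<beta> b (1 + r).\<close>
  define R where "R = 1 + 2 * \<delta> + 4 * \<beta> * b"
  have "0 \<le> \<delta>" "0 \<le> \<beta> * b"
    using b(1) assms(4) by (auto simp: \<delta>_def)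
  have "lsc_fun h"
    unfolding h_def add.commute[of "g _"]
    by (intro lsc_fun_add_continuous assms continuous_intros)
  moreover have "y \<in> cball y R"
    using \<open>0 \<le> \<delta>\<close> \<open>0 \<le> \<beta> * b\<close> by (simp add: R_def)
  ultimately obtain p where p: "\<And>z. z \<in> cball y R \<Longrightarrow> h p \<le> h z"
    using lsc_fun_attains_min[OF _ compact_cball, of h y R] by (metis empty_iff)
  have "h p \<le> h z" for z
  proof (cases "z \<in> cball y R")
    case False
    define r where "r = norm (z - y)"
    have r: "R < r"
      using False by (simp add: r_def dist_norm norm_minus_commute)
    then have r': "1 < r" "0 \<le> r - \<delta>"
      using \<open>0 \<le> \<delta>\<close> \<open>0 \<le> \<beta> * b\<close> by (auto simp: R_def)
    have "r - \<delta> \<le> norm (z - x)"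
      using norm_triangle_ineq4[of "z - x" "y - x"] by (simp add: r_def \<delta>_def)
    then have "(r - \<delta>)\<^sup>2 \<le> (norm (z - x))\<^sup>2"
      using r' by (intro power_mono) auto
    moreover have "2 * \<beta> * (b * (1 + r)) \<le> (r - \<delta>)\<^sup>2 - \<delta>\<^sup>2"
    proof -
      have "2 * \<beta> * (b * (1 + r)) = 2 * (\<beta> * b) * (1 + r)"
        by simp
      also have "\<dots> \<le> 2 * (\<beta> * b) * (2 * r)"
        using r' \<open>0 \<le> \<beta> * b\<close> by (intro mult_left_mono) auto
      also have "\<dots> \<le> r * (R - 2 * \<delta>)"
        using r' by (simp add: R_def algebra_simps)
      also have "\<dots> \<le> r * (r - 2 * \<delta>)"
        using r r' by (intro mult_left_mono) auto
      finally show ?thesis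
        by (simp add: power2_eq_square algebra_simps)
    qed
    ultimately have "2 * \<beta> * (b * (1 + r)) \<le> (norm (z - x))\<^sup>2 - \<delta>\<^sup>2"
      by linarith
    then have *: "b * (1 + r) \<le> ((norm (z - x))\<^sup>2 - \<delta>\<^sup>2) / (2 * \<beta>)"
      using assms(4) by (simp add: pos_le_divide_eq mult.commute)
    have "h p \<le> h y"
      using p[OF \<open>y \<in> cball y R\<close>] .
    also have "\<dots> = ereal (a + 1 / (2 * \<beta>) * \<delta>\<^sup>2)"
      by (simp add: h_def a \<delta>_def)
    also have "\<dots> \<le> ereal (a - b * (1 + r)) + ereal (1 / (2 * \<beta>) * (norm (z - x))\<^sup>2)"
      using * by (simp add: diff_divide_distrib)
    also have "\<dots> \<le> h z"
      unfolding h_def r_def by (intro add_right_mono b(2))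
    finally show ?thesis .
  qed (rule p)
  then show thesis
    using that[of p] by (simp add: argmin_set_def is_arg_min_def h_def not_less)
qed

text \<open>The optimality condition: \<open>(x - p) /\<^sub>R \<beta>\<close> is a subgradient of
  \<open>g\<close> at \<open>p\<close>. It results from comparing \<open>p\<close> with points at
  parameter \<open>t\<close> on the segment towards \<open>y\<close> and letting \<open>t\<close>
  tend to 0.\<close>

lemma prox_minimizer_variational:
  fixes g :: "'a::euclidean_space \<Rightarrow> ereal"
  assumes "proper_fun g" "convex_fun g" "0 < \<beta>"
    and p: "p \<in> argmin_set (\<lambda>z. g z + ereal (1 / (2 * \<beta>) * (norm (z - x))\<^sup>2))"
  obtains a where "g p = ereal a" "\<And>y. ereal (a + (x - p) \<bullet> (y - p) / \<beta>) \<le> g y"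
proof -
  have min: "g p + ereal (1 / (2 * \<beta>) * (norm (p - x))\<^sup>2)
      \<le> g z + ereal (1 / (2 * \<beta>) * (norm (z - x))\<^sup>2)" for z
    using p by (simp add: argmin_set_def is_arg_min_def not_less)
  obtain y where "g y \<noteq> \<infinity>"
    using assms(1) unfolding proper_fun_def by blast
  then have "g p \<noteq> \<infinity>"
    using min[of y] by auto
  then obtain a where a: "g p = ereal a"
    using proper_fun_realE[OF assms(1)] by blast
  have "ereal (a + (x - p) \<bullet> (y - p) / \<beta>) \<le> g y" for y
  proof (cases "g y = \<infinity>")
    case False
    then obtain c where c: "g y = ereal c"
      using proper_fun_realE[OF assms(1)] by blast
    have *: "a + (x - p) \<bullet> (y - p) / \<beta> - c \<le> t * (1 / (2 * \<beta>) * (norm (y - p))\<^sup>2)"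
      if t: "0 < t" "t < 1" for t
    proof -
      define z where "z = (1 - t) *\<^sub>R p + t *\<^sub>R y"
      have zx: "z - x = (p - x) + t *\<^sub>R (y - p)"
        by (simp add: z_def algebra_simps)
      have "g z \<le> ereal ((1 - t) * a + t * c)"
        using assms(2)[unfolded convex_fun_def, rule_format, of t p y] t a c
        by (simp add: z_def)
      then have gz: "g z + ereal (1 / (2 * \<beta>) * (norm (z - x))\<^sup>2)
          \<le> ereal ((1 - t) * a + t * c) + ereal (1 / (2 * \<beta>) * (norm (z - x))\<^sup>2)"
        by (rule add_right_mono)
      have "t * (a - c) \<le> 1 / (2 * \<beta>) * ((norm (z - x))\<^sup>2 - (norm (p - x))\<^sup>2)"
        using order_trans[OF min gz] a by (simp add: algebra_simps)
      also have "(norm (z - x))\<^sup>2 - (norm (p - x))\<^sup>2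
          = t * (t * (norm (y - p))\<^sup>2 - 2 * ((x - p) \<bullet> (y - p)))"
        unfolding zx power2_norm_eq_inner
        by (simp add: inner_add inner_diff inner_commute algebra_simps)
      also have "1 / (2 * \<beta>) * \<dots>
          = t * (t * (1 / (2 * \<beta>) * (norm (y - p))\<^sup>2) - (x - p) \<bullet> (y - p) / \<beta>)"
        using assms(3) by (simp add: field_simps)
      finally have "a - c \<le> t * (1 / (2 * \<beta>) * (norm (y - p))\<^sup>2) - (x - p) \<bullet> (y - p) / \<beta>"
        using t by simp
      then show ?thesis
        by linarith
    qed
    have "((\<lambda>t. t * (1 / (2 * \<beta>) * (norm (y - p))\<^sup>2)) \<longlongrightarrow> 0 * (1 / (2 * \<beta>) * (norm (y - p))\<^sup>2))
        (at_right 0)"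
      by (intro tendsto_intros)
    moreover have "\<forall>\<^sub>F t in at_right 0.
        a + (x - p) \<bullet> (y - p) / \<beta> - c \<le> t * (1 / (2 * \<beta>) * (norm (y - p))\<^sup>2)"
      using * by (intro eventually_at_rightI[of 0 1]) auto
    ultimately have "a + (x - p) \<bullet> (y - p) / \<beta> - c \<le> 0"
      using tendsto_lowerbound by fastforce
    then show ?thesis
      using c by simp
  qed simp
  with a show thesis
    using that by blast
qed

text \<open>Applying the variational inequality at each of two minimizers to the other and adding
  forces their squared distance to be at most 0. This uniqueness, with existence, is what makes the
  \<open>THE\<close> in \<open>prox\<close> denote a minimizer.\<close>

lemma prox_variational:
  fixes g :: "'a::euclidean_space \<Rightarrow> ereal"
  assumes "proper_fun g" "convex_fun g" "lsc_fun g" "0 < \<beta>"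
  obtains a where "g (prox \<beta> g x) = ereal a"
    "\<And>y. ereal (a + (x - prox \<beta> g x) \<bullet> (y - prox \<beta> g x) / \<beta>) \<le> g y"
proof -
  let ?M = "argmin_set (\<lambda>z. g z + ereal (1 / (2 * \<beta>) * (norm (z - x))\<^sup>2))"
  have unique: "p = p'" if p: "p \<in> ?M" and p': "p' \<in> ?M" for p p'
  proof -
    obtain a where a: "g p = ereal a" "ereal (a + (x - p) \<bullet> (p' - p) / \<beta>) \<le> g p'"
      using prox_minimizer_variational[OF assms(1,2,4) p] by metis
    obtain a' where a': "g p' = ereal a'" "ereal (a' + (x - p') \<bullet> (p - p') / \<beta>) \<le> g p"
      using prox_minimizer_variational[OF assms(1,2,4) p'] by metis
    have "((x - p) \<bullet> (p' - p) + (x - p') \<bullet> (p - p')) / \<beta> \<le> 0"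
      using a a' by (simp add: add_divide_distrib)
    then have "(p' - p) \<bullet> (p' - p) \<le> 0"
      using assms(4) by (simp add: divide_le_0_iff inner_diff inner_commute)
    then have "(norm (p' - p))\<^sup>2 \<le> 0"
      unfolding power2_norm_eq_inner .
    then show ?thesis
      by simp
  qed
  obtain p where "p \<in> ?M"
    using prox_exists[OF assms] .
  with unique have "prox \<beta> g x \<in> ?M"
    unfolding prox_def by (intro theI[of "\<lambda>z. z \<in> ?M" p]) auto
  then show thesis
    using prox_minimizer_variational[OF assms(1,2,4)] that by blast
qed

section \<open>First-order bounds for differentiable functions\<close>

lemma has_real_derivative_along_line:
  fixes f :: "'a::euclidean_space \<Rightarrow> real"
  assumes "\<forall>y. f differentiable (at y)"
  shows "((\<lambda>t. f (x + t *\<^sub>R v)) has_real_derivative gradient f (x + t *\<^sub>R v) \<bullet> v) (at t)"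
proof -
  have "((\<lambda>t. x + t *\<^sub>R v) has_derivative (\<lambda>s. s *\<^sub>R v)) (at t)"
    by (auto intro!: derivative_eq_intros)
  moreover have "(f has_derivative (\<lambda>h. h \<bullet> gradient f (x + t *\<^sub>R v))) (at (x + t *\<^sub>R v))"
    using GDERIV_gradient assms unfolding gderiv_def by blast
  ultimately have "((\<lambda>t. f (x + t *\<^sub>R v)) has_derivative
      (\<lambda>s. s *\<^sub>R v \<bullet> gradient f (x + t *\<^sub>R v))) (at t)"
    by (rule has_derivative_compose)
  then show ?thesis
    by (simp add: has_field_derivative_def inner_commute mult_commute_abs)
qed

text \<open>Restriction to the line through \<open>x\<close> and \<open>y\<close> reduces the claim
  to the tangent inequality in one variable.\<close>

lemma convex_on_above_gradient:
  fixes f :: "'a::euclidean_space \<Rightarrow> real"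
  assumes "\<forall>y. f differentiable (at y)" "convex_on UNIV f"
  shows "f x + gradient f x \<bullet> (y - x) \<le> f y"
proof -
  have "convex_on UNIV (\<lambda>t. f (x + t *\<^sub>R (y - x)))"
  proof (rule convex_onI)
    fix t a b :: real assume t: "0 < t" "t < 1"
    have "x + ((1 - t) *\<^sub>R a + t *\<^sub>R b) *\<^sub>R (y - x)
        = (1 - t) *\<^sub>R (x + a *\<^sub>R (y - x)) + t *\<^sub>R (x + b *\<^sub>R (y - x))"
      by (simp add: algebra_simps)
    then show "f (x + ((1 - t) *\<^sub>R a + t *\<^sub>R b) *\<^sub>R (y - x))
        \<le> (1 - t) * f (x + a *\<^sub>R (y - x)) + t * f (x + b *\<^sub>R (y - x))"
      using convex_onD[OF assms(2), of t] t by simp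
  qed simp
  from convex_on_imp_above_tangent[OF this, of 0 1]
  show ?thesis
    using has_real_derivative_along_line[OF assms(1), of x "y - x" 0] by fastforce
qed

lemma lipschitz_gradient_descent:
  fixes f :: "'a::euclidean_space \<Rightarrow> real"
  assumes "\<forall>y. f differentiable (at y)" "L-lipschitz_on UNIV (gradient f)"
  shows "f y \<le> f x + gradient f x \<bullet> (y - x) + L / 2 * (norm (y - x))\<^sup>2"
proof -
  define v where "v = y - x"
  \<comment> \<open>Along the segment, subtract from \<open>f\<close> the linear term of its tangent
    at \<open>x\<close> and the quadratic allowance; the Lipschitz bound makes the derivative
    nonpositive.\<close>
  define \<phi> where "\<phi> t = f (x + t *\<^sub>R v) - t * (gradient f x \<bullet> v) - L / 2 * (norm v)\<^sup>2 * t\<^sup>2" for t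
  have "\<phi> 1 \<le> \<phi> 0"
  proof (rule DERIV_nonpos_imp_nonincreasing[of 0 1 \<phi>])
    fix t :: real assume t: "0 \<le> t" "t \<le> 1"
    have "(\<phi> has_real_derivative
        gradient f (x + t *\<^sub>R v) \<bullet> v - gradient f x \<bullet> v - L * (norm v)\<^sup>2 * t) (at t)"
      unfolding \<phi>_def using has_real_derivative_along_line[OF assms(1), of x v t]
      by (auto intro!: derivative_eq_intros)
    moreover have "gradient f (x + t *\<^sub>R v) \<bullet> v - gradient f x \<bullet> v \<le> L * (norm v)\<^sup>2 * t"
    proof -
      have "(gradient f (x + t *\<^sub>R v) - gradient f x) \<bullet> v
          \<le> norm (gradient f (x + t *\<^sub>R v) - gradient f x) * norm v"
        by (rule norm_cauchy_schwarz)
      also have "\<dots> \<le> L * norm (t *\<^sub>R v) * norm v"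
        using lipschitz_onD[OF assms(2), of "x + t *\<^sub>R v" x]
        by (intro mult_right_mono) (auto simp: dist_norm)
      finally show ?thesis
        using t by (simp add: inner_diff_left power2_eq_square mult_ac)
    qed
    ultimately show "\<exists>d. DERIV \<phi> t :> d \<and> d \<le> 0"
      by (intro exI conjI) auto
  qed simp
  then show ?thesis
    by (simp add: \<phi>_def v_def)
qed

section \<open>One accepted forward-backward step\<close>

text \<open>Three bounds are added: the proximal variational inequality for \<open>g\<close>, the
  gradient inequality for \<open>f\<close> at \<open>z\<close>, and the failed line search test as
  an upper bound on \<open>f p\<close>. The gradient terms cancel.\<close>

lemma fb_step_inequality:
  fixes f :: "'a::euclidean_space \<Rightarrow> real"
  assumes "proper_fun g" "convex_fun g" "lsc_fun g"
    and "\<forall>y. f differentiable (at y)" "convex_on UNIV f"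
    and "0 < \<beta>" "\<not> backtrack_test f g \<beta> x"
  defines "p \<equiv> fb_step f g \<beta> x"
  obtains a where "ereal (f p) + g p = ereal a"
    "\<And>z. ereal (a + ((dist p z)\<^sup>2 - (dist x z)\<^sup>2) / (2 * \<beta>)) \<le> ereal (f z) + g z"
proof -
  let ?d = "gradient f x"
  obtain b where b: "g p = ereal b"
    and var: "\<And>z. ereal (b + (x - \<beta> *\<^sub>R ?d - p) \<bullet> (z - p) / \<beta>) \<le> g z"
    using prox_variational[OF assms(1-3,6), of "x - \<beta> *\<^sub>R ?d"]
    unfolding p_def fb_step_def by metis
  have descent: "f p \<le> f x + ?d \<bullet> (p - x) + 1 / (2 * \<beta>) * (norm (p - x))\<^sup>2"
    using assms(7) unfolding backtrack_test_def p_def by simp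
  have "ereal (f p + b + ((dist p z)\<^sup>2 - (dist x z)\<^sup>2) / (2 * \<beta>)) \<le> ereal (f z) + g z" for z
  proof -
    have "(x - \<beta> *\<^sub>R ?d - p) \<bullet> (z - p) / \<beta> = (x - p) \<bullet> (z - p) / \<beta> - ?d \<bullet> (z - p)"
      using assms(6) by (simp add: inner_diff_left diff_divide_distrib)
    \<comment> \<open>Law of cosines; the squared step length it produces cancels exactly against
      the quadratic term of the failed test.\<close>
    moreover have "(x - p) \<bullet> (z - p) / \<beta>
        = ((norm (p - x))\<^sup>2 + ((dist p z)\<^sup>2 - (dist x z)\<^sup>2)) / (2 * \<beta>)"
      unfolding dist_norm power2_norm_eq_inner
      using assms(6) by (simp add: inner_diff inner_commute field_simps)
    moreover have "f x + ?d \<bullet> (z - x) \<le> f z"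
      by (rule convex_on_above_gradient) fact+
    ultimately have "f p + b + ((dist p z)\<^sup>2 - (dist x z)\<^sup>2) / (2 * \<beta>)
        \<le> f z + (b + (x - \<beta> *\<^sub>R ?d - p) \<bullet> (z - p) / \<beta>)"
      using descent by (simp add: inner_diff_right add_divide_distrib)
    then have "ereal (f p + b + ((dist p z)\<^sup>2 - (dist x z)\<^sup>2) / (2 * \<beta>))
        \<le> ereal (f z) + ereal (b + (x - \<beta> *\<^sub>R ?d - p) \<bullet> (z - p) / \<beta>)"
      by simp
    also have "\<dots> \<le> ereal (f z) + g z"
      by (intro add_left_mono var)
    finally show ?thesis .
  qed
  then show thesis
    using that[of "f p + b"] b by simp
qed

section \<open>Sequences governed by the step inequality\<close>

text \<open>Only the step inequality is retained from the algorithm. \<open>F (x 0)\<close> may be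
  infinite, so \<open>r k\<close> is the value at \<open>x (Suc k)\<close>.\<close>

locale proximal_descent =
  fixes F :: "'a::euclidean_space \<Rightarrow> ereal" and x :: "nat \<Rightarrow> 'a" and \<alpha> :: "nat \<Rightarrow> real"
    and r :: "nat \<Rightarrow> real"
  assumes step_pos: "0 < \<alpha> k"
    and value_Suc: "F (x (Suc k)) = ereal (r k)"
    and step_inequality:
      "ereal (r k + ((dist (x (Suc k)) z)\<^sup>2 - (dist (x k) z)\<^sup>2) / (2 * \<alpha> k)) \<le> F z"
begin

lemma dist_Suc_le:
  assumes "F z \<le> ereal (r k)"
  shows "dist (x (Suc k)) z \<le> dist (x k) z"
proof -
  have "((dist (x (Suc k)) z)\<^sup>2 - (dist (x k) z)\<^sup>2) / (2 * \<alpha> k) \<le> 0"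
    using order_trans[OF step_inequality[of k] assms] by simp
  then have "(dist (x (Suc k)) z)\<^sup>2 \<le> (dist (x k) z)\<^sup>2"
    using step_pos[of k] by (simp add: divide_le_0_iff)
  then show ?thesis
    by (rule power2_le_imp_le) simp
qed

lemma decseq_value: "decseq r"
proof (rule decseq_SucI)
  fix k
  have "r (Suc k) + (dist (x (Suc (Suc k))) (x (Suc k)))\<^sup>2 / (2 * \<alpha> (Suc k)) \<le> r k"
    using step_inequality[of "Suc k" "x (Suc k)"] value_Suc[of k] by simp
  moreover have "0 \<le> (dist (x (Suc (Suc k))) (x (Suc k)))\<^sup>2 / (2 * \<alpha> (Suc k))"
    using step_pos[of "Suc k"] by simp
  ultimately show "r (Suc k) \<le> r k"
    by linarith
qed

lemma self_contracted: "self_contracted x"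
  unfolding self_contracted_def
proof (intro allI impI)
  fix i j k :: nat assume "i \<le> j" "j \<le> k"
  then show "dist (x j) (x k) \<le> dist (x i) (x k)"
  proof (induction j rule: dec_induct)
    case (step j)
    \<comment> \<open>Values are known to be real only at positive indices: the value at
      \<open>x k\<close> is \<open>r l\<close>, and it is at most \<open>r j\<close> by
      monotonicity.\<close>
    then obtain l where l: "k = Suc l" "j \<le> l"
      by (metis Suc_le_D Suc_le_mono)
    then have "F (x k) \<le> ereal (r j)"
      using decseqD[OF decseq_value] value_Suc by simp
    then have "dist (x (Suc j)) (x k) \<le> dist (x j) (x k)"
      by (rule dist_Suc_le)
    with step show ?case
      by simp
  qed simp
qed

lemma dist_argmin_le:
  assumes "s \<in> argmin_set F"
  shows "dist (x k) s \<le> dist (x 0) s"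
proof (induction k)
  case (Suc k)
  have "F s \<le> ereal (r k)"
    using assms unfolding argmin_set_def is_arg_min_def value_Suc[symmetric] by (simp add: not_less)
  then show ?case
    using dist_Suc_le Suc by fastforce
qed simp

text \<open>If \<open>l\<close> were not a minimizer, lower semicontinuity would keep the values
  above some \<open>c\<close> greater than the minimum \<open>m\<close>. The step inequality at a
  minimizer \<open>s\<close> then charges each \<open>\<alpha> k\<close>, times 2 (c - m), to the
  decrease of the squared distance to \<open>s\<close>; telescoping makes \<open>\<alpha>\<close>
  summable.\<close>

lemma limit_in_argmin:
  assumes "lsc_fun F" "argmin_set F \<noteq> {}" "x \<longlonglongrightarrow> l" "\<not> summable \<alpha>"
  shows "l \<in> argmin_set F"
proof (rule ccontr)
  assume "l \<notin> argmin_set F"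
  then obtain y where "F y < F l"
    unfolding argmin_set_def is_arg_min_def by auto
  obtain s where s: "s \<in> argmin_set F"
    using assms(2) by blast
  then have min: "F s \<le> F z" for z
    unfolding argmin_set_def is_arg_min_def by (simp add: not_less)
  have "F s \<noteq> \<infinity>" "F s \<noteq> -\<infinity>"
    using min[of "x (Suc 0)"] value_Suc[of 0] step_inequality[of 0 s] by auto
  then obtain m where m: "F s = ereal m"
    by (cases "F s") auto
  have "ereal m < F l"
    using min[of y] \<open>F y < F l\<close> m by simp
  then obtain c where c: "m < c" "ereal c < F l"
    using ereal_dense2 by fastforce
  have "open {z. ereal c < F z}"
    using assms(1) unfolding lsc_fun_iff_open by blast
  then have "\<forall>\<^sub>F k in sequentially. ereal c < F (x k)"
    using topological_tendstoD[OF assms(3), of "{z. ereal c < F z}"] c(2) by simp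
  then obtain N where N: "\<And>k. N \<le> k \<Longrightarrow> ereal c < F (x k)"
    unfolding eventually_sequentially by blast
  \<comment> \<open>The eventual bound holds for every index because the values decrease.\<close>
  have c_less: "c < r k" for k
    using N[of "Suc (max N k)"] value_Suc[of "max N k"] decseqD[OF decseq_value, of k "max N k"]
    by (simp add: le_SucI)
  have "\<alpha> k * (2 * (c - m)) \<le> (dist (x k) s)\<^sup>2 - (dist (x (Suc k)) s)\<^sup>2" for k
  proof -
    have "c - m \<le> ((dist (x k) s)\<^sup>2 - (dist (x (Suc k)) s)\<^sup>2) / (2 * \<alpha> k)"
      using step_inequality[of k s] m c_less[of k] by (simp add: diff_divide_distrib)
    then show ?thesis
      using step_pos[of k] by (simp add: pos_le_divide_eq mult_ac)
  qed
  then have "(\<Sum>k<n. \<alpha> k * (2 * (c - m)))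
      \<le> (\<Sum>k<n. (dist (x k) s)\<^sup>2 - (dist (x (Suc k)) s)\<^sup>2)" for n
    by (rule sum_mono)
  then have "(\<Sum>k<n. \<alpha> k * (2 * (c - m))) \<le> (dist (x 0) s)\<^sup>2 - (dist (x n) s)\<^sup>2" for n
    unfolding sum_lessThan_telescope'[of "\<lambda>k. (dist (x k) s)\<^sup>2"] .
  then have "(\<Sum>k<n. \<alpha> k * (2 * (c - m))) \<le> (dist (x 0) s)\<^sup>2" for n
    by (rule order_trans) simp
  then have "summable (\<lambda>k. \<alpha> k * (2 * (c - m)))"
    using step_pos c(1) by (intro summableI_nonneg_bounded) (auto intro: less_imp_le)
  then have "summable (\<lambda>k. \<alpha> k * (2 * (c - m)) / (2 * (c - m)))"
    by (rule summable_divide)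
  then show False
    using assms(4) c(1) by simp
qed

end

section \<open>Finite length and convergence of the forward-backward iteration\<close>

theorem mainTheorem5:
  shows "\<exists>C::real. \<forall>(f :: real^'n \<Rightarrow> real) (g :: real^'n \<Rightarrow> ereal) (L::real)
      (x :: nat \<Rightarrow> real^'n) (\<alpha> :: nat \<Rightarrow> real) (S :: (real^'n) set).
    proper_fun g \<longrightarrow> convex_fun g \<longrightarrow> lsc_fun g \<longrightarrow>
    (\<forall>y. f differentiable (at y)) \<longrightarrow> convex_on UNIV f \<longrightarrow>
    L > 0 \<longrightarrow> L-lipschitz_on UNIV (gradient f) \<longrightarrow>
    S = argmin_set (\<lambda>y. ereal (f y) + g y) \<longrightarrow> S \<noteq> {} \<longrightarrow>
    (\<forall>k. \<alpha> k > 0) \<longrightarrow>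
    (\<forall>k. x (Suc k) = prox (\<alpha> k) g (x k - \<alpha> k *\<^sub>R gradient f (x k))) \<longrightarrow>
    ((\<forall>k. \<alpha> k < 1 / L)
      \<or> (\<exists>\<alpha>0 q. \<alpha>0 > 0 \<and> 0 < q \<and> q < 1 \<and> backtracking_steps f g \<alpha>0 q x \<alpha>)
      \<or> f = (\<lambda>_. 0)
      \<or> (g = (\<lambda>_. 0) \<and> (\<forall>k. \<alpha> k \<le> 1 / L))) \<longrightarrow>
    summable (\<lambda>k. norm (x (Suc k) - x k))
    \<and> (\<Sum>k. norm (x (Suc k) - x k)) \<le> C * infdist (x 0) S
    \<and> (\<exists>x_inf. x \<longlonglongrightarrow> x_inf \<and> (\<not> summable \<alpha> \<longrightarrow> x_inf \<in> S))"
proof -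
  \<comment> \<open>Obtained before any of \<open>f\<close>, \<open>g\<close>, \<open>L\<close>,
    \<open>x\<close>, \<open>\<alpha>\<close> is fixed, so it depends on the dimension only.\<close>
  obtain C :: real where C: "0 \<le> C"
    "\<And>(x :: nat \<Rightarrow> real^'n) c D n. self_contracted x
      \<Longrightarrow> (\<And>k. dist (x k) c \<le> D) \<Longrightarrow> (\<Sum>k<n. norm (x (Suc k) - x k)) \<le> C * D"
    using self_contracted_length_le by metis
  show ?thesis
  proof (rule exI[of _ C], intro allI impI)
    fix f :: "real^'n \<Rightarrow> real" and g :: "real^'n \<Rightarrow> ereal" and L :: real
      and x :: "nat \<Rightarrow> real^'n" and \<alpha> :: "nat \<Rightarrow> real" and S :: "(real^'n) set"
    assume g: "proper_fun g" "convex_fun g" "lsc_fun g"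
      and f: "\<forall>y. f differentiable (at y)" "convex_on UNIV f"
      and L: "L > 0" "L-lipschitz_on UNIV (gradient f)"
      and S: "S = argmin_set (\<lambda>y. ereal (f y) + g y)" "S \<noteq> {}"
      and \<alpha>: "\<forall>k. \<alpha> k > 0"
      and x: "\<forall>k. x (Suc k) = prox (\<alpha> k) g (x k - \<alpha> k *\<^sub>R gradient f (x k))"
      and cases: "(\<forall>k. \<alpha> k < 1 / L)
        \<or> (\<exists>\<alpha>0 q. \<alpha>0 > 0 \<and> 0 < q \<and> q < 1 \<and> backtracking_steps f g \<alpha>0 q x \<alpha>)
        \<or> f = (\<lambda>_. 0)
        \<or> (g = (\<lambda>_. 0) \<and> (\<forall>k. \<alpha> k \<le> 1 / L))"
    have fb: "x (Suc k) = fb_step f g (\<alpha> k) (x k)" for k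
      using x by (simp add: fb_step_def)
    \<comment> \<open>Shared by the two rules with steps bounded by 1/L: there the descent
      inequality for Lipschitz gradients implies acceptance.\<close>
    have small: "\<not> backtrack_test f g (\<alpha> k) (x k)" if "\<alpha> k \<le> 1 / L" for k
    proof -
      have "L / 2 \<le> 1 / (2 * \<alpha> k)"
        using that L(1) \<alpha> by (simp add: field_simps)
      then have "L / 2 * (norm (x (Suc k) - x k))\<^sup>2 \<le> 1 / (2 * \<alpha> k) * (norm (x (Suc k) - x k))\<^sup>2"
        by (rule mult_right_mono) simp
      then show ?thesis
        using lipschitz_gradient_descent[OF f(1) L(2), of "x (Suc k)" "x k"]
        unfolding backtrack_test_def fb[symmetric] by linarith
    qed
    have accepted: "\<not> backtrack_test f g (\<alpha> k) (x k)" for k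
      using cases
    proof (elim disjE exE conjE)
      assume "\<forall>k. \<alpha> k < 1 / L"
      then show ?thesis
        by (intro small) (simp add: less_imp_le)
    next
      fix \<alpha>0 q assume "backtracking_steps f g \<alpha>0 q x \<alpha>"
      then show ?thesis
        unfolding backtracking_steps_def by metis
    next
      assume "f = (\<lambda>_. 0)"
      moreover from this have "gradient f (x k) = 0"
        by (auto intro: gradient_eqI GDERIV_const)
      ultimately show ?thesis
        using \<alpha> by (simp add: backtrack_test_def not_less less_imp_le)
    next
      assume "\<forall>k. \<alpha> k \<le> 1 / L"
      then show ?thesis
        by (intro small) simp
    qed
    define F where "F = (\<lambda>y. ereal (f y) + g y)"
    have "\<exists>a. F (x (Suc k)) = ereal a \<and> (\<forall>z.
        ereal (a + ((dist (x (Suc k)) z)\<^sup>2 - (dist (x k) z)\<^sup>2) / (2 * \<alpha> k)) \<le> F z)" for k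
      using fb_step_inequality[OF g f _ accepted, of k] \<alpha> unfolding fb F_def by metis
    then obtain r where r: "\<And>k. F (x (Suc k)) = ereal (r k)"
      "\<And>k z. ereal (r k + ((dist (x (Suc k)) z)\<^sup>2 - (dist (x k) z)\<^sup>2) / (2 * \<alpha> k)) \<le> F z"
      by metis
    interpret proximal_descent F x \<alpha> r
      using \<alpha> r by unfold_locales auto
    have S_F: "S = argmin_set F"
      using S(1) by (simp add: F_def)
    have sum_le: "(\<Sum>k<n. norm (x (Suc k) - x k)) \<le> C * dist (x 0) s" if "s \<in> S" for n s
      using C(2)[OF self_contracted] dist_argmin_le that S_F by blast
    obtain s0 where "s0 \<in> S"
      using S(2) by blast
    have summable: "summable (\<lambda>k. norm (x (Suc k) - x k))"
      using sum_le[OF \<open>s0 \<in> S\<close>] by (intro summableI_nonneg_bounded) auto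
    have suminf_le: "(\<Sum>k. norm (x (Suc k) - x k)) \<le> C * dist (x 0) s" if "s \<in> S" for s
      by (rule suminf_le_const[OF summable sum_le[OF that]])
    have "(\<Sum>k. norm (x (Suc k) - x k)) \<le> C * infdist (x 0) S"
    \<comment> \<open>For positive \<open>C\<close>, dividing by \<open>C\<close> turns the bounds
      for single minimizers into a lower bound for the infimum of distances.\<close>
    proof (cases "C = 0")
      case True
      then show ?thesis
        using suminf_le[OF \<open>s0 \<in> S\<close>] by simp
    next
      case False
      with C(1) have "(\<Sum>k. norm (x (Suc k) - x k)) / C \<le> dist (x 0) s" if "s \<in> S" for s
        using suminf_le[OF that] by (simp add: pos_divide_le_eq mult.commute)
      then have "(\<Sum>k. norm (x (Suc k) - x k)) / C \<le> infdist (x 0) S"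
        using S(2) by (simp add: infdist_notempty cINF_greatest)
      with False C(1) show ?thesis
        by (simp add: pos_divide_le_eq mult.commute)
    qed
    moreover have "convergent x"
    proof -
      \<comment> \<open>The partial sums of the absolutely convergent series of increments telescope
        to the iterates.\<close>
      have "(\<lambda>n. x 0 + (\<Sum>k<n. x (Suc k) - x k)) \<longlonglongrightarrow> x 0 + (\<Sum>k. x (Suc k) - x k)"
        by (intro tendsto_intros summable_LIMSEQ summable_norm_cancel[OF summable])
      then show ?thesis
        unfolding convergent_def by (auto simp: sum_lessThan_telescope)
    qed
    then obtain l where l: "x \<longlonglongrightarrow> l"
      unfolding convergent_def by blast
    moreover have "l \<in> S" if "\<not> summable \<alpha>"
    proof -
      have "lsc_fun F"
        unfolding F_def using f(1)
        by (intro lsc_fun_add_continuous g differentiable_imp_continuous_on)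
           (simp add: differentiable_on_def)
      then show ?thesis
        using limit_in_argmin l that S(2) S_F by blast
    qed
    ultimately show "summable (\<lambda>k. norm (x (Suc k) - x k))
      \<and> (\<Sum>k. norm (x (Suc k) - x k)) \<le> C * infdist (x 0) S
      \<and> (\<exists>x_inf. x \<longlonglongrightarrow> x_inf \<and> (\<not> summable \<alpha> \<longrightarrow> x_inf \<in> S))"
      using summable by blast
  qed
qed

end
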